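(* Let $\mathcal{G}$ be a countable family of analytic hypergraphs on a Polish space $X$ with the small anticlique property, such that every edge of every hypergraph in $\mathcal{G}$ is infinite and an infinite subset of an edge is again an edge. Let $P$ be a $\sigma$-liminf-centered forcing. Then $\mathcal{G}\not\perp^*P$ holds.
   Context: For a Polish space $X$, $X^{\leq\omega}$ denotes the space of all finite sequences and all $\omega$-sequences of elements of $X$. A hypergraph on $X$ is a set $G\subset X^{\leq\omega}$; its elements are called edges. $G$ is analytic if it is an analytic subset of $X^{\leq\omega}$. A $G$-anticlique is a set $B\subset X$ with $B^{\leq\omega}\cap G=\emptyset$. For a countable collection $\mathcal{G}$ of hypergraphs on $X$, $I_{\mathcal{G}}$ is the $\sigma$-ideal on $X$ $\sigma$-generated by the Borel sets which are anticliques in at least one of the hypergraphs in $\mathcal{G}$; a set is $I_{\mathcal{G}}$-positive if it is not in $I_{\mathcal{G}}$. In the hypotheses, edges are identified with their sets of vertices: every edge $e$ of every $G\in\mathcal{G}$ has infinite range, and for every $G\in\mathcal{G}$ and $e\in G$, every infinite subset of $\mathrm{rng}(e)$ is again (the range of) an edge in $G$. $\mathcal{G}$ has the small anticlique property if for every sequence $\langle B_n,G_n\colon n\in\omega\rangle$ such that $G_n\in\mathcal{G}$ and $B_n\subset X$ is an arbitrary (not necessarily Borel) $G_n$-anticlique, the union $\bigcup_nB_n$ does not contain an analytic $I_{\mathcal{G}}$-positive subset. A subset $Q$ of a poset $P$ is liminf-centered if for every infinite set $a\subset Q$ there is a condition $p\in P$ forcing that infinitely many elements of $a$ belong to the generic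 filter. $P$ is $\sigma$-liminf-centered if it is the union of countably many liminf-centered subsets. For a partial ordering $P$ (with no definability requirement), $\mathcal{G}\not\perp^*P$ denotes the following statement: for every Borel $I_{\mathcal{G}}$-positive set $B\subset X$, every function $f\colon B\to P$ and every $G\in\mathcal{G}$, there is a condition $p\in P$ which forces that there is an edge $e\in G$ whose vertices are ground model elements of $B$ such that $f''\mathrm{rng}(e)$ is a subset of the generic filter. *)

theory Defs
  imports "HOL-Analysis.Analysis"
begin

section \<open>Hypergraphs on a Polish space\<close>

text \<open>
  A point of \<open>X\<^sup>\<le>\<^sup>\<omega>\<close> is a pair of its length \<open>\<alpha> \<le> \<omega>\<close> and a function that is
  extensional on \<open>{i. i < \<alpha>}\<close>.  The topology is that of the disjoint sum of the spaces
  \<open>X\<^sup>\<alpha>\<close>, each with the product topology.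
\<close>

type_synonym 'a sequence = "enat \<times> (nat \<Rightarrow> 'a)"
type_synonym 'a hypergraph = "'a sequence set"

definition idx :: "enat \<Rightarrow> nat set" where
  "idx \<alpha> = {i. enat i < \<alpha>}"

definition seqs :: "'a set \<Rightarrow> 'a sequence set" where
  "seqs B = (SIGMA \<alpha>:UNIV. idx \<alpha> \<rightarrow>\<^sub>E B)"

definition seq_space :: "'a::topological_space sequence topology" where
  "seq_space = sum_topology (\<lambda>\<alpha>. product_topology (\<lambda>_. euclidean) (idx \<alpha>)) UNIV"

lemma topspace_seq_space: "topspace seq_space = seqs UNIV"
  by (auto simp: seq_space_def seqs_def)

definition rng :: "'a sequence \<Rightarrow> 'a set" where
  "rng e = snd e ` idx (fst e)"

text \<open>
  Analytic sets are projections of closed subsets of the product with the Baire space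
  \<open>nat \<Rightarrow> nat\<close>.  The closed set is kept as a separate notion because it is what determines the
  interpretation of an analytic set in a generic extension.
\<close>

definition analytic_code :: "'b topology \<Rightarrow> ('b \<times> (nat \<Rightarrow> nat)) set \<Rightarrow> 'b set \<Rightarrow> bool" where
  "analytic_code Y C A \<longleftrightarrow> closedin (prod_topology Y euclidean) C \<and> A = fst ` C"

definition analytic_in :: "'b topology \<Rightarrow> 'b set \<Rightarrow> bool" where
  "analytic_in Y A \<longleftrightarrow> (\<exists>C. analytic_code Y C A)"

definition anticlique :: "'a hypergraph \<Rightarrow> 'a set \<Rightarrow> bool" where
  "anticlique G B \<longleftrightarrow> seqs B \<inter> G = {}"

definition hg_ideal :: "'a::topological_space hypergraph set \<Rightarrow> 'a set set" where
  "hg_ideal \<G> =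
    {A. \<exists>\<S>. countable \<S> \<and> (\<forall>S\<in>\<S>. S \<in> sets borel \<and> (\<exists>G\<in>\<G>. anticlique G S)) \<and> A \<subseteq> \<Union>\<S>}"

definition small_anticlique_property :: "'a::topological_space hypergraph set \<Rightarrow> bool" where
  "small_anticlique_property \<G> \<longleftrightarrow>
    (\<forall>(B :: nat \<Rightarrow> 'a set) (G :: nat \<Rightarrow> 'a hypergraph).
      (\<forall>n. G n \<in> \<G> \<and> anticlique (G n) (B n)) \<longrightarrow>
      \<not> (\<exists>A. A \<subseteq> (\<Union>n. B n) \<and> analytic_in euclidean A \<and> A \<notin> hg_ideal \<G>))"


section \<open>The forcing relation\<close>

text \<open>
  The forcing poset is the type \<open>'p\<close>, with \<open>q \<le> p\<close> meaning that \<open>q\<close> is the stronger condition.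
  A sentence of the forcing language is represented by the predicate on conditions that holds of
  exactly those which force it; the connectives below are the usual recursive clauses of the
  forcing relation.  \<open>AllF\<close> and \<open>ExF\<close> range over a set \<open>A\<close> given in the ground model: \<open>A\<close> is
  either a set of ground model objects (bounded quantification over the check name of \<open>A\<close>) or a
  set of names (quantification over the objects of the extension which they name).
\<close>

type_synonym 'p sentence = "'p \<Rightarrow> bool"

definition forces :: "'p \<Rightarrow> 'p sentence \<Rightarrow> bool"  (infix "\<tturnstile>" 50) where
  "p \<tturnstile> \<phi> \<longleftrightarrow> \<phi> p"

definition NotF :: "'p::order sentence \<Rightarrow> 'p sentence" where
  "NotF \<phi> = (\<lambda>p. \<forall>q\<le>p. \<not> q \<tturnstile> \<phi>)"

definition AndF :: "'p::order sentence \<Rightarrow> 'p sentence \<Rightarrow> 'p sentence" where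
  "AndF \<phi> \<psi> = (\<lambda>p. p \<tturnstile> \<phi> \<and> p \<tturnstile> \<psi>)"

definition ImpF :: "'p::order sentence \<Rightarrow> 'p sentence \<Rightarrow> 'p sentence" where
  "ImpF \<phi> \<psi> = NotF (AndF \<phi> (NotF \<psi>))"

definition AllF :: "'i set \<Rightarrow> ('i \<Rightarrow> 'p::order sentence) \<Rightarrow> 'p sentence" where
  "AllF A \<phi> = (\<lambda>p. \<forall>x\<in>A. p \<tturnstile> \<phi> x)"

definition ExF :: "'i set \<Rightarrow> ('i \<Rightarrow> 'p::order sentence) \<Rightarrow> 'p sentence" where
  "ExF A \<phi> = (\<lambda>p. \<forall>q\<le>p. \<exists>r\<le>q. \<exists>x\<in>A. r \<tturnstile> \<phi> x)"

text \<open>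
  Names for subsets of the ground model type \<open>'i\<close>: a pair \<open>(x, r)\<close> in the name stands for the
  pair of the check name of \<open>x\<close> and the condition \<open>r\<close>.  Every subset of a ground model set in
  the generic extension has a name of this form.
\<close>

type_synonym ('i, 'p) name = "('i \<times> 'p) set"

definition InF :: "'i \<Rightarrow> ('i, 'p::order) name \<Rightarrow> 'p sentence" where
  "InF x \<tau> = (\<lambda>p. \<forall>q\<le>p. \<exists>r\<le>q. \<exists>s. (x, s) \<in> \<tau> \<and> r \<le> s)"

definition generic_name :: "('p, 'p::order) name" where
  "generic_name = {(p, p) | p. True}"


section \<open>Liminf-centered forcings\<close>

text \<open>A finite subset of \<open>a\<close> in the extension already belongs to the ground model.\<close>

definition inf_many_generic :: "'p::order set \<Rightarrow> 'p sentence" where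
  "inf_many_generic a =
    AllF {F. finite F \<and> F \<subseteq> a} (\<lambda>F. ExF (a - F) (\<lambda>b. InF b generic_name))"

definition liminf_centered :: "'p::order set \<Rightarrow> bool" where
  "liminf_centered Q \<longleftrightarrow> (\<forall>a\<subseteq>Q. infinite a \<longrightarrow> (\<exists>p. p \<tturnstile> inf_many_generic a))"

definition sigma_liminf_centered :: "'p::order itself \<Rightarrow> bool" where
  "sigma_liminf_centered (_ :: 'p itself) \<longleftrightarrow>
    (\<exists>Q :: nat \<Rightarrow> 'p set. (\<forall>n. liminf_centered (Q n)) \<and> (\<Union>n. Q n) = UNIV)"


section \<open>Edges in the generic extension\<close>

text \<open>The object named by \<open>\<tau>\<close> is a function from \<open>D\<close> to \<open>A\<close>, both being ground model sets.\<close>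

definition FunF :: "'i set \<Rightarrow> 'b set \<Rightarrow> ('i \<times> 'b, 'p::order) name \<Rightarrow> 'p sentence" where
  "FunF D A \<tau> =
    AndF (AllF (- (D \<times> A)) (\<lambda>z. NotF (InF z \<tau>)))
   (AndF (AllF D (\<lambda>i. ExF A (\<lambda>x. InF (i, x) \<tau>)))
         (AllF {(i, x, y). i \<in> D \<and> x \<in> A \<and> y \<in> A \<and> x \<noteq> y}
            (\<lambda>(i, x, y). NotF (AndF (InF (i, x) \<tau>) (InF (i, y) \<tau>)))))"

text \<open>
  Basic open sets of \<open>X\<^sup>\<le>\<^sup>\<omega> \<times> \<omega>\<^sup>\<omega>\<close>, and membership of a pair \<open>(e, y)\<close> of the extension in their
  reinterpretation there, where \<open>e\<close> has length \<open>\<alpha>\<close> and its entries are points of the ground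
  model (so that an entry lies in the reinterpretation of the open set \<open>U i\<close> iff it lies in
  \<open>U i\<close>).
\<close>

definition basic_open ::
    "enat \<Rightarrow> nat \<Rightarrow> (nat \<Rightarrow> 'a set) \<Rightarrow> (nat \<Rightarrow> nat) \<Rightarrow> ('a sequence \<times> (nat \<Rightarrow> nat)) set" where
  "basic_open \<alpha> n U s =
    {((\<beta>, x), z). \<beta> = \<alpha> \<and> x \<in> idx \<alpha> \<rightarrow>\<^sub>E UNIV \<and>
       (\<forall>i<n. (i \<in> idx \<alpha> \<longrightarrow> x i \<in> U i) \<and> z i = s i)}"

definition InBasicF ::
    "enat \<Rightarrow> nat \<Rightarrow> (nat \<Rightarrow> 'a set) \<Rightarrow> (nat \<Rightarrow> nat) \<Rightarrow>
     (nat \<times> 'a, 'p::order) name \<Rightarrow> (nat \<times> nat, 'p) name \<Rightarrow> 'p sentence" where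
  "InBasicF \<alpha> n U s e y =
    AndF (AllF {i. i < n \<and> i \<in> idx \<alpha>} (\<lambda>i. ExF (U i) (\<lambda>x. InF (i, x) e)))
         (AllF {i. i < n} (\<lambda>i. InF (i, s i) y))"

text \<open>
  An open set \<open>W\<close> is reinterpreted as the union of the reinterpretations of the ground model
  basic open subsets of \<open>W\<close>, a closed set as the complement of the reinterpreted complement, and
  an analytic set as the projection of the reinterpretation of a closed set coding it.  By
  analytic absoluteness the result does not depend on the code.
\<close>

definition InOpenF ::
    "('a::topological_space sequence \<times> (nat \<Rightarrow> nat)) set \<Rightarrow> enat \<Rightarrow>
     (nat \<times> 'a, 'p::order) name \<Rightarrow> (nat \<times> nat, 'p) name \<Rightarrow> 'p sentence" where
  "InOpenF W \<alpha> e y =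
    ExF {(n, U, s). (\<forall>i. open (U i)) \<and> basic_open \<alpha> n U s \<subseteq> W}
        (\<lambda>(n, U, s). InBasicF \<alpha> n U s e y)"

definition InAnalyticF ::
    "('a::topological_space sequence \<times> (nat \<Rightarrow> nat)) set \<Rightarrow> enat \<Rightarrow>
     (nat \<times> 'a, 'p::order) name \<Rightarrow> 'p sentence" where
  "InAnalyticF C \<alpha> e =
    ExF UNIV (\<lambda>y. AndF (FunF UNIV UNIV y) (NotF (InOpenF (seqs UNIV \<times> UNIV - C) \<alpha> e y)))"

text \<open>
  The sentence saying that there is an edge, of the hypergraph coded by \<open>C\<close>, whose vertices are
  ground model elements of \<open>B\<close> and whose \<open>f\<close>-image is a subset of the generic filter.
\<close>

definition GenericEdgeF ::
    "('a::topological_space sequence \<times> (nat \<Rightarrow> nat)) set \<Rightarrow> 'a set \<Rightarrow> ('a \<Rightarrow> 'p::order) \<Rightarrow>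
     'p sentence" where
  "GenericEdgeF C B f =
    ExF UNIV (\<lambda>\<alpha>. ExF UNIV (\<lambda>e.
      AndF (FunF (idx \<alpha>) B e)
     (AndF (InAnalyticF C \<alpha> e)
           (AllF (idx \<alpha> \<times> B) (\<lambda>(i, x). ImpF (InF (i, x) e) (InF (f x) generic_name))))))"

text \<open>
  \<open>f\<close> is a total function on the type of points, but only its restriction to \<open>B\<close> matters.
\<close>

definition not_perp_star :: "'a::topological_space hypergraph set \<Rightarrow> 'p::order itself \<Rightarrow> bool" where
  "not_perp_star \<G> (_ :: 'p itself) \<longleftrightarrow>
    (\<forall>B \<in> sets borel. B \<notin> hg_ideal \<G> \<longrightarrow>
      (\<forall>(f :: 'a \<Rightarrow> 'p). \<forall>G\<in>\<G>. \<exists>p. \<forall>C. analytic_code seq_space C G \<longrightarrow> p \<tturnstile> GenericEdgeF C B f))"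

end

theory Submission
  imports Defs
begin

text \<open>
  Split \<open>B\<close> according to the liminf-centered piece containing \<open>f x\<close>.  By the small anticlique
  property one of the parts contains an edge of \<open>G\<close>.  This edge has an infinite subset \<open>a\<close> on which
  \<open>f\<close> is constant or injective, and in both cases some condition forces \<open>b = {x \<in> a. f x \<in> g}\<close> to
  be infinite, where \<open>g\<close> is the generic filter.  It remains to find an edge inside \<open>b\<close> in the
  extension, knowing that every infinite subset of \<open>a\<close> in the ground model is an edge.  As in
  Shoenfield's absoluteness theorem, consider the tree searching for an edge inside \<open>b\<close> together
  with a witness of its membership in the coding closed set.  If some condition forced this tree to
  be well-founded, a descending sequence of conditions deciding \<open>b\<close> and the rank function of the
  tree would produce a counterexample in the ground model.  So the tree is forced to have a branch.
\<close>

section \<open>Borel sets are analytic\<close>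

lemma analytic_in_euclidean_iff:
  "analytic_in (euclidean :: 'a::topological_space topology) A \<longleftrightarrow> 
    (\<exists>C :: ('a \<times> (nat \<Rightarrow> nat)) set. closed C \<and> A = fst ` C)"
  by (simp add: analytic_in_def analytic_code_def)

lemma continuous_on_reindex:
  "continuous_on UNIV (\<lambda>v :: 'a::topological_space \<times> (nat \<Rightarrow> nat). (fst v, \<lambda>i. snd v (g i)))"
  by (intro continuous_intros continuous_on_coordinatewise_then_product
      continuous_on_product_then_coordinatewise)

lemma analytic_in_closed:
  fixes A :: "'a::topological_space set"
  assumes "closed A"
  shows "analytic_in euclidean A"
  unfolding analytic_in_euclidean_iff
proof (intro exI[of _ "A \<times> UNIV"] conjI)
  show "closed (A \<times> (UNIV :: (nat \<Rightarrow> nat) set))"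
    using assms by (simp add: closed_Times)
qed simp

lemma analytic_in_UN:
  fixes A :: "nat \<Rightarrow> 'a::topological_space set"
  assumes "\<And>n. analytic_in euclidean (A n)"
  shows "analytic_in euclidean (\<Union>n. A n)"
proof -
  obtain C :: "nat \<Rightarrow> ('a \<times> (nat \<Rightarrow> nat)) set" where C: "\<And>n. closed (C n)" "\<And>n. A n = fst ` C n"
    using assms unfolding analytic_in_euclidean_iff by metis
  \<comment> \<open>Entry 0 of a witness names one of the sets; the shifted tail is a witness for
    that set.\<close>
  let ?D = "\<Inter>n. ({v. snd v 0 \<noteq> n} \<union> (\<lambda>v. (fst v, \<lambda>i. snd v (Suc i))) -` C n)"
  have "closed {v :: 'a \<times> (nat \<Rightarrow> nat). snd v 0 \<noteq> n}" for n
  proof -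
    have "continuous_on UNIV (\<lambda>v :: 'a \<times> (nat \<Rightarrow> nat). snd v 0)"
      by (intro continuous_intros continuous_on_product_then_coordinatewise)
    moreover have "closed (- {n})"
      by (simp add: closed_def open_discrete)
    ultimately have "closed ((\<lambda>v :: 'a \<times> (nat \<Rightarrow> nat). snd v 0) -` (- {n}))"
      by (rule closed_vimage[rotated])
    then show ?thesis by (simp add: vimage_def)
  qed
  moreover have "closed ((\<lambda>v. (fst v, \<lambda>i. snd v (Suc i))) -` C n)" for n
    using C(1) continuous_on_reindex by (rule closed_vimage)
  ultimately have "closed ?D" by auto
  moreover have "(\<Union>n. A n) = fst ` ?D"
  proof (intro set_eqI iffI)
    fix x assume "x \<in> (\<Union>n. A n)"
    then obtain n z where "(x, z) \<in> C n" using C(2) by force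
    then have "(x, case_nat n z) \<in> ?D" by auto
    then show "x \<in> fst ` ?D" by (rule rev_image_eqI) simp
  next
    fix x assume "x \<in> fst ` ?D"
    then obtain z where "(x, z) \<in> ?D" by auto
    then have "(x, \<lambda>i. z (Suc i)) \<in> C (z 0)" by auto
    then show "x \<in> (\<Union>n. A n)" using C(2) by force
  qed
  ultimately show ?thesis unfolding analytic_in_euclidean_iff by blast
qed

lemma analytic_in_INT:
  fixes A :: "nat \<Rightarrow> 'a::topological_space set"
  assumes "\<And>n. analytic_in euclidean (A n)"
  shows "analytic_in euclidean (\<Inter>n. A n)"
proof -
  obtain C :: "nat \<Rightarrow> ('a \<times> (nat \<Rightarrow> nat)) set" where C: "\<And>n. closed (C n)" "\<And>n. A n = fst ` C n"
    using assms unfolding analytic_in_euclidean_iff by metis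
  let ?D = "\<Inter>n. (\<lambda>v. (fst v, \<lambda>i. snd v (prod_encode (n, i)))) -` C n"
  have "closed ((\<lambda>v. (fst v, \<lambda>i. snd v (prod_encode (n, i)))) -` C n)" for n
    using C(1) continuous_on_reindex by (rule closed_vimage)
  then have "closed ?D" by auto
  moreover have "(\<Inter>n. A n) = fst ` ?D"
  proof (intro set_eqI iffI)
    fix x assume "x \<in> (\<Inter>n. A n)"
    then have "\<forall>n. \<exists>z. (x, z) \<in> C n" using C(2) by force
    then obtain z where "\<And>n. (x, z n) \<in> C n" by metis
    then have "(x, \<lambda>j. case prod_decode j of (n, i) \<Rightarrow> z n i) \<in> ?D" by auto
    then show "x \<in> fst ` ?D" by (rule rev_image_eqI) simp
  next
    fix x assume "x \<in> fst ` ?D"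
    then obtain z where "(x, z) \<in> ?D" by auto
    then have "(x, \<lambda>i. z (prod_encode (n, i))) \<in> C n" for n by auto
    then show "x \<in> (\<Inter>n. A n)" using C(2) by force
  qed
  ultimately show ?thesis unfolding analytic_in_euclidean_iff by blast
qed

lemma analytic_in_open:
  fixes A :: "'a::metric_space set"
  assumes "open A"
  shows "analytic_in euclidean A"
proof -
  have "fsigma_in euclidean A"
    using assms open_imp_fsigma_in[OF metrizable_space_euclidean] by simp
  then obtain F where "\<And>n::nat. closed (F n)" "A = (\<Union>n. F n)"
    by (auto simp: fsigma_in_ascending)
  then show ?thesis using analytic_in_closed analytic_in_UN by metis
qed

text \<open>Analyticity need not pass to complements, so the induction treats \<open>A\<close> and
  \<open>- A\<close> together.\<close>

lemma analytic_in_borel: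
  fixes A :: "'a::metric_space set"
  assumes "A \<in> sets borel"
  shows "analytic_in euclidean A"
proof -
  have "A \<in> sigma_sets UNIV {S. open S}"
    using assms by (simp add: borel_def)
  then have "analytic_in euclidean A \<and> analytic_in euclidean (- A)"
  proof (induction rule: sigma_sets.induct)
    case (Basic a)
    then show ?case by (simp add: analytic_in_open analytic_in_closed closed_Compl)
  next
    case Empty
    then show ?case by (simp add: analytic_in_closed)
  next
    case (Compl a)
    then show ?case by (simp add: Compl_eq_Diff_UNIV double_diff)
  next
    case (Union a)
    then show ?case using analytic_in_UN[of a] analytic_in_INT[of "\<lambda>n. - a n"] by simp
  qed
  then show ?thesis ..
qed


section \<open>Well-founded trees in the generic extension\<close>

text \<open>Well-founded trees replace ordinals: descent becomes structural induction, and
  \<open>Rank F\<close> offers a rank for every child at every condition.\<close>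

datatype 'i rank = Undef | Rank "'i \<Rightarrow> 'i rank"

text \<open>
  Nodes are finite sequences in reverse order, so that the children of \<open>t\<close> are the lists \<open>k # t\<close>.
  In the extension, the tree consists of the nodes \<open>t\<close> in \<open>T\<close> with \<open>h k\<close> in the generic filter
  for all entries \<open>k\<close> of \<open>t\<close>.  A condition for which \<open>ranked\<close> holds forces the subtree above the
  node to be well-founded.  The subtree above an \<open>unranked\<close> node is forced to be ill-founded, and
  always moving to the least unranked child singles out one branch without choosing antichains.
\<close>

context
  fixes T :: "nat list \<Rightarrow> bool" and h :: "nat \<Rightarrow> 'p::order"
begin

definition admissible :: "'p \<Rightarrow> nat list \<Rightarrow> bool" where
  "admissible q t \<longleftrightarrow> T t \<and> (\<forall>k\<in>set t. q \<le> h k)"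

primrec ranked :: "('p \<times> nat) rank \<Rightarrow> 'p \<Rightarrow> nat list \<Rightarrow> bool" where
  "ranked Undef q t = False"
| "ranked (Rank F) q t =
    (\<forall>r\<le>q. \<forall>k. admissible r (k # t) \<longrightarrow> (\<exists>r'\<le>r. ranked (F (r, k)) r' (k # t)))"

definition unranked :: "'p \<Rightarrow> nat list \<Rightarrow> bool" where
  "unranked q t \<longleftrightarrow> admissible q t \<and> (\<forall>r\<le>q. \<forall>\<rho>. \<not> ranked \<rho> r t)"

primrec leftmost :: "'p \<Rightarrow> nat list \<Rightarrow> bool" where
  "leftmost q [] = unranked q []"
| "leftmost q (k # t) =
    (leftmost q t \<and> unranked q (k # t) \<and> (\<forall>j<k. \<forall>r\<le>q. \<not> unranked r (j # t)))"

definition branch_name :: "(nat \<Rightarrow> 'b) \<Rightarrow> (nat \<times> 'b, 'p) name" where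
  "branch_name \<phi> = {((i, \<phi> (rev t ! i)), r) | i t r. leftmost r t \<and> i < length t}"

lemma ranked_mono: "ranked \<rho> q t \<Longrightarrow> r \<le> q \<Longrightarrow> ranked \<rho> r t"
  by (cases \<rho>) (auto dest: order_trans)

lemma unranked_mono: "unranked q t \<Longrightarrow> r \<le> q \<Longrightarrow> unranked r t"
  unfolding unranked_def admissible_def by (meson order_trans)

text \<open>If no child were unranked below \<open>q\<close>, choice would collect ranks of the
  children into some \<open>F\<close>, and \<open>Rank F\<close> would rank
  \<open>t\<close>.\<close>

lemma unranked_extend:
  assumes "unranked q t"
  shows "\<exists>r\<le>q. \<exists>k. unranked r (k # t)"
proof (rule ccontr)
  assume "\<not> ?thesis"
  then have "\<forall>x. \<exists>\<rho>. fst x \<le> q \<longrightarrow> admissible (fst x) (snd x # t) \<longrightarrow>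
      (\<exists>r'\<le>fst x. ranked \<rho> r' (snd x # t))"
    unfolding unranked_def by blast
  then obtain F where "\<And>x. fst x \<le> q \<Longrightarrow> admissible (fst x) (snd x # t) \<Longrightarrow>
      \<exists>r'\<le>fst x. ranked (F x) r' (snd x # t)"
    by metis
  then have "ranked (Rank F) q t" by force
  then show False using assms unfolding unranked_def by blast
qed

lemma leftmost_mono: "leftmost q t \<Longrightarrow> r \<le> q \<Longrightarrow> leftmost r t"
  by (induction t) (auto intro: unranked_mono dest: order_trans)

lemma leftmost_imp_unranked: "leftmost q t \<Longrightarrow> unranked q t"
  by (cases t) auto

text \<open>Minimising over all conditions below \<open>q\<close> makes smaller siblings fail at
  each of them, as \<open>leftmost\<close> demands.\<close>

lemma leftmost_extend:
  assumes "leftmost q t"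
  shows "\<exists>r\<le>q. \<exists>k. leftmost r (k # t)"
proof -
  let ?P = "\<lambda>k. \<exists>r\<le>q. unranked r (k # t)"
  obtain k where k: "?P k" and min: "\<And>j. j < k \<Longrightarrow> \<not> ?P j"
    using unranked_extend[OF leftmost_imp_unranked[OF assms]] exists_least_iff[of ?P] by blast
  then obtain r where "r \<le> q" "unranked r (k # t)" by blast
  then have "leftmost r (k # t)"
    using assms min leftmost_mono by (auto dest: order_trans)
  then show ?thesis using \<open>r \<le> q\<close> by blast
qed

lemma leftmost_long:
  assumes "leftmost q []"
  shows "\<exists>r\<le>q. \<exists>t. length t = n \<and> leftmost r t"
proof (induction n)
  case 0
  then show ?case using assms by blast
next
  case (Suc n)
  then show ?case using leftmost_extend by (metis length_Cons order_trans)
qed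

text \<open>Of two distinct heads over the same tail, the smaller is unranked at \<open>q\<close>,
  which the minimality of the larger forbids.\<close>

lemma leftmost_unique:
  "length t = length t' \<Longrightarrow> leftmost q t \<Longrightarrow> leftmost q t' \<Longrightarrow> t = t'"
proof (induction t t' rule: list_induct2)
  case (Cons x xs y ys)
  then show ?case by simp (metis linorder_neqE_nat order_refl)
qed simp

lemma leftmost_drop: "leftmost q t \<Longrightarrow> leftmost q (drop n t)"
  by (induction t arbitrary: n) (auto simp: drop_Cons split: nat.split)

lemma leftmost_nth_unique:
  assumes "leftmost q t" "leftmost q t'" "i < length t" "i < length t'"
  shows "rev t ! i = rev t' ! i"
proof -
  have "drop (length t - Suc i) t = drop (length t' - Suc i) t'"
    using assms by (intro leftmost_unique[where q = q] leftmost_drop) auto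
  then show ?thesis
    using assms
    by (metis rev_nth hd_drop_conv_nth diff_Suc_less gr_implies_not0 length_0_conv
        length_greater_0_conv)
qed

lemma InF_branch_nameI:
  assumes "leftmost q t" "i < length t"
  shows "InF (i, \<phi> (rev t ! i)) (branch_name \<phi>) q"
  unfolding InF_def branch_name_def using assms by blast

text \<open>The name may admit \<open>(i, x)\<close> through another condition, but that one and
  \<open>r\<close> have a common extension, where leftmost nodes agree.\<close>

lemma InF_branch_nameD:
  assumes "InF (i, x) (branch_name \<phi>) q" "r \<le> q" "leftmost r t" "i < length t"
  shows "x = \<phi> (rev t ! i)"
proof -
  obtain r' s t' where "r' \<le> r" "r' \<le> s" "leftmost s t'" "i < length t'" "x = \<phi> (rev t' ! i)"
    using assms(1,2) unfolding InF_def branch_name_def by blast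
  then show ?thesis
    using leftmost_nth_unique leftmost_mono assms(3,4) by metis
qed

lemma FunF_branch_name:
  assumes "leftmost q []" "range \<phi> \<subseteq> A"
  shows "FunF UNIV A (branch_name \<phi>) q"
proof -
  have long: "\<exists>r\<le>q'. \<exists>t. i < length t \<and> leftmost r t" if "q' \<le> q" for q' i
    using leftmost_long[OF leftmost_mono[OF assms(1) that], of "Suc i"] by (metis lessI)
  have "\<not> InF z (branch_name \<phi>) r" if "z \<notin> UNIV \<times> A" for z r
  proof
    assume "InF z (branch_name \<phi>) r"
    then obtain s where "(z, s) \<in> branch_name \<phi>" unfolding InF_def by blast
    then show False using that assms(2) by (auto simp: branch_name_def)
  qed
  moreover have "\<exists>r\<le>q'. \<exists>x\<in>A. InF (i, x) (branch_name \<phi>) r" if "q' \<le> q" for q' i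
    using long[OF that, of i] InF_branch_nameI assms(2) by (meson rangeI subsetD)
  moreover have "x = y"
    if q': "q' \<le> q" and x: "InF (i, x) (branch_name \<phi>) q'"
      and y: "InF (i, y) (branch_name \<phi>) q'" for q' i x y
  proof -
    obtain r t where "r \<le> q'" "i < length t" "leftmost r t"
      using long[OF q'] by blast
    then show ?thesis
      using InF_branch_nameD[OF x] InF_branch_nameD[OF y] by simp
  qed
  ultimately show ?thesis
    by (auto simp: FunF_def AndF_def AllF_def ExF_def NotF_def forces_def)
qed

text \<open>
  The state of the construction is a condition and a partial assignment \<open>\<sigma>\<close> of ranks to nodes, with
  \<open>Undef\<close> for nodes without a rank.  Step \<open>n\<close> treats the node with code \<open>n\<close>; under \<open>list_encode\<close>
  a parent has a smaller code than its children, so it is treated first.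
\<close>

lemma not_ranked_root:
  fixes c :: "nat \<Rightarrow> 'p" and u :: "nat \<Rightarrow> nat"
  assumes h: "\<And>k. h k = c (u k)"
    and dense: "\<And>n q. q \<le> p \<Longrightarrow> \<exists>r\<le>q. \<exists>m\<ge>n. r \<le> c m"
    and branch: "\<And>b. infinite b \<Longrightarrow> \<exists>w. (\<forall>n. T (rev (map w [0..<n]))) \<and> (\<forall>i. u (w i) \<in> b)"
  shows "\<not> ranked \<rho> p []"
proof
  assume \<rho>: "ranked \<rho> p []"
  define Inv :: "'p \<times> (nat list \<Rightarrow> ('p \<times> nat) rank) \<Rightarrow> bool" where
    "Inv = (\<lambda>(q, \<sigma>). q \<le> p \<and> \<sigma> [] \<noteq> Undef \<and> (\<forall>t. \<sigma> t \<noteq> Undef \<longrightarrow> ranked (\<sigma> t) q t))"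
  \<comment> \<open>Going below some \<open>c m\<close> with \<open>m \<ge> n\<close> makes
    infinitely many indices enter the filter. The root has code 0, so step 0 must preserve its
    rank.\<close>
  define Step :: "nat \<Rightarrow> 'p \<times> (nat list \<Rightarrow> ('p \<times> nat) rank) \<Rightarrow>
      'p \<times> (nat list \<Rightarrow> ('p \<times> nat) rank) \<Rightarrow> bool" where
    "Step = (\<lambda>n (q, \<sigma>) (q', \<sigma>'). q' \<le> q \<and> (\<exists>m\<ge>n. q' \<le> c m) \<and>
      (\<forall>t. t = [] \<or> t \<noteq> list_decode n \<longrightarrow> \<sigma>' t = \<sigma> t) \<and>
      (\<forall>k t F r. list_decode n = k # t \<and> \<sigma> t = Rank F \<and> r \<le> q \<and> admissible r (k # t) \<longrightarrow>
        \<sigma>' (k # t) \<noteq> Undef \<and> \<sigma>' (k # t) \<in> range F))"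
  have "\<exists>s. \<forall>n. Inv (s n) \<and> Step n (s n) (s (Suc n))"
  proof (rule dependent_nat_choice[where P = "\<lambda>_. Inv" and Q = Step])
    have "\<rho> \<noteq> Undef" using \<rho> by auto
    then show "\<exists>x. Inv x"
      using \<rho> by (intro exI[of _ "(p, \<lambda>t. if t = [] then \<rho> else Undef)"]) (simp add: Inv_def)
  next
    fix x n assume "Inv x"
    then obtain q \<sigma> where x: "x = (q, \<sigma>)" and q: "q \<le> p" and nil: "\<sigma> [] \<noteq> Undef"
      and rk: "\<And>t. \<sigma> t \<noteq> Undef \<Longrightarrow> ranked (\<sigma> t) q t"
      unfolding Inv_def by (cases x) auto
    show "\<exists>y. Inv y \<and> Step n x y"
    proof (cases "\<exists>k t F r. list_decode n = k # t \<and> \<sigma> t = Rank F \<and> r \<le> q \<and> admissible r (k # t)")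
      case True
      then obtain k t F r where *: "list_decode n = k # t" "\<sigma> t = Rank F" "r \<le> q" "admissible r (k # t)"
        by blast
      then have "ranked (Rank F) q t" using rk[of t] by simp
      then obtain r' where r': "r' \<le> r" "ranked (F (r, k)) r' (k # t)"
        using *(3,4) by auto
      moreover obtain q' m where q': "q' \<le> r'" "n \<le> m" "q' \<le> c m"
        using dense[of r' n] r'(1) *(3) q by (meson order_trans)
      ultimately have F: "ranked (F (r, k)) q' (k # t)" "q' \<le> q"
        using *(3) by (auto intro: ranked_mono)
      then have "F (r, k) \<noteq> Undef" by auto
      then have "Inv (q', \<sigma>(k # t := F (r, k)))"
        using F q nil ranked_mono[OF rk] unfolding Inv_def by (auto dest: order_trans)
      moreover have "Step n x (q', \<sigma>(k # t := F (r, k)))"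
        using F q' * \<open>F (r, k) \<noteq> Undef\<close> unfolding Step_def x by auto
      ultimately show ?thesis by blast
    next
      case False
      obtain q' m where q': "q' \<le> q" "n \<le> m" "q' \<le> c m"
        using dense[of q n] q by blast
      then have "Inv (q', \<sigma>)"
        using q nil ranked_mono[OF rk] unfolding Inv_def by (auto dest: order_trans)
      moreover have "Step n x (q', \<sigma>)"
        using q'(1) q'(2,3) False unfolding Step_def x by auto
      ultimately show ?thesis by blast
    qed
  qed
  then obtain s where Inv: "\<And>n. Inv (s n)" and Step: "\<And>n. Step n (s n) (s (Suc n))"
    by blast
  define P where "P n = fst (s n)" for n
  define \<sigma> where "\<sigma> n = snd (s n)" for n
  have P_Suc: "P (Suc n) \<le> P n"
    and P_c: "\<exists>m\<ge>n. P (Suc n) \<le> c m"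
    and \<sigma>_Suc: "t = [] \<or> t \<noteq> list_decode n \<Longrightarrow> \<sigma> (Suc n) t = \<sigma> n t"
    and \<sigma>_Cons: "list_decode n = k # t \<Longrightarrow> \<sigma> n t = Rank F \<Longrightarrow> r \<le> P n \<Longrightarrow> admissible r (k # t) \<Longrightarrow>
        \<sigma> (Suc n) (k # t) \<noteq> Undef \<and> \<sigma> (Suc n) (k # t) \<in> range F" for n t k F r
    using Step[of n] unfolding Step_def P_def \<sigma>_def by (auto simp: case_prod_beta)
  have P_mono: "P n \<le> P m" if "m \<le> n" for m n
    using that P_Suc by (rule lift_Suc_antimono_le[rotated])
  \<comment> \<open>Only step \<open>list_encode t\<close> can change the rank of
    \<open>t\<close>.\<close>
  have \<sigma>_stable: "\<sigma> n t = \<sigma> (Suc (list_encode t)) t" if "list_encode t < n" for n t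
    using that
  proof (induction n)
    case (Suc n)
    show ?case
    proof (cases "n = list_encode t")
      case False
      then have "list_encode t < n" using Suc.prems by simp
      moreover have "t \<noteq> list_decode n" using False by (metis list_decode_inverse)
      ultimately show ?thesis using Suc.IH \<sigma>_Suc by simp
    qed simp
  qed simp
  \<comment> \<open>This infinite ground model set stands in for the generic one, so it yields an
    actual branch \<open>w\<close>.\<close>
  define b where "b = {m. \<exists>n. P n \<le> c m}"
  have "infinite b"
    unfolding infinite_nat_iff_unbounded_le b_def using P_c by blast
  then obtain w where w: "\<And>n. T (rev (map w [0..<n]))" "\<And>i. u (w i) \<in> b"
    using branch by blast
  define t where "t n = rev (map w [0..<n])" for n
  have t_Suc: "t (Suc n) = w n # t n" for n by (simp add: t_def)
  have admissible_t: "\<exists>r\<le>P m. admissible r (t n)" for m n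
  proof -
    have "\<forall>i. \<exists>N. P N \<le> h (w i)" using w(2) h by (auto simp: b_def)
    then obtain N where N: "\<And>i. P (N i) \<le> h (w i)" by metis
    define M where "M = m + (\<Sum>i<n. N i)"
    have "P M \<le> h (w i)" if "i < n" for i
    proof -
      have "N i \<le> M"
        unfolding M_def using that by (intro trans_le_add2 member_le_sum) auto
      then show ?thesis using P_mono N order_trans by blast
    qed
    then have "admissible (P M) (t n)" using w(1) by (auto simp: admissible_def t_def)
    then show ?thesis using P_mono[of m M] by (auto simp: M_def)
  qed
  \<comment> \<open>Each node along \<open>w\<close> is admissible below every \<open>P m\<close>,
    so a ranked node would pass an immediate subtree of its rank to its successor.\<close>
  have no_rank: "\<sigma> m (t n) = \<tau> \<Longrightarrow> list_encode (t n) < m \<Longrightarrow> \<tau> = Undef" for \<tau> m n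
  proof (induction \<tau> arbitrary: m n)
    case (Rank F)
    let ?m = "list_encode (t (Suc n))"
    have "list_encode (t n) < ?m"
      by (simp add: t_Suc le_prod_encode_2 le_imp_less_Suc)
    then have "\<sigma> ?m (t n) = Rank F"
      using Rank.prems \<sigma>_stable by metis
    moreover obtain r where "r \<le> P ?m" "admissible r (t (Suc n))"
      using admissible_t by blast
    moreover have "list_decode ?m = w n # t n" by (simp only: t_Suc list_encode_inverse)
    ultimately have "\<sigma> (Suc ?m) (t (Suc n)) \<noteq> Undef \<and> \<sigma> (Suc ?m) (t (Suc n)) \<in> range F"
      using \<sigma>_Cons t_Suc by metis
    then show ?case using Rank.IH by (metis lessI)
  qed simp
  have "\<sigma> 1 [] \<noteq> Undef"
    using Inv[of 1] unfolding Inv_def \<sigma>_def by (auto simp: case_prod_beta)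
  then show False using no_rank[of 1 0] by (simp add: t_def)
qed

end


section \<open>The generic edge\<close>

lemma idx_infinity [simp]: "idx \<infinity> = UNIV"
  by (simp add: idx_def)

lemma finite_rng_enat: "finite (rng (enat n, x))"
  by (simp add: rng_def idx_def)

lemma ExFI:
  assumes "x \<in> A" "\<And>q. q \<le> p \<Longrightarrow> \<phi> x q"
  shows "ExF A \<phi> p"
  using assms by (auto simp: ExF_def forces_def)

text \<open>The hypothesis \<open>dense\<close> says that \<open>p\<close> forces \<open>f x\<close>
  into the generic filter for infinitely many \<open>x\<close> in \<open>a\<close>. The leftmost
  branch of the search tree names an edge and its witness.\<close>

lemma forces_GenericEdgeF:
  fixes f :: "'a::topological_space \<Rightarrow> 'p::order"
  assumes a: "countable a" "infinite a" "a \<subseteq> B"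
    and edges: "\<And>a'. a' \<subseteq> a \<Longrightarrow> infinite a' \<Longrightarrow> \<exists>e\<in>fst ` C. rng e = a'"
    and dense: "\<And>F q. finite F \<Longrightarrow> q \<le> p \<Longrightarrow> \<exists>r\<le>q. \<exists>x\<in>a - F. r \<le> f x"
  shows "p \<tturnstile> GenericEdgeF C B f"
proof -
  obtain \<nu> :: "nat \<Rightarrow> 'a" where \<nu>: "bij_betw \<nu> UNIV a"
    using countable_infiniteE'[OF a(1,2)] by blast
  \<comment> \<open>An entry \<open>k\<close> codes a vertex \<open>\<nu> (u k)\<close> and a value
    \<open>v k\<close> of the witness.\<close>
  define u v where "u = (\<lambda>k. fst (prod_decode k))" and "v = (\<lambda>k. snd (prod_decode k))"
  define T where "T t \<longleftrightarrow> (\<exists>x z. ((\<infinity>, x), z) \<in> C \<and>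
    (\<forall>i<length t. x i = \<nu> (u (rev t ! i)) \<and> z i = v (rev t ! i)))" for t :: "nat list"
  define h where "h k = f (\<nu> (u k))" for k
  have branch: "\<exists>w. (\<forall>n. T (rev (map w [0..<n]))) \<and> (\<forall>i. u (w i) \<in> b)" if "infinite b" for b
  proof -
    have "infinite (\<nu> ` b)"
      using that \<nu> by (metis bij_betw_imp_inj_on finite_imageD inj_on_subset subset_UNIV)
    moreover have "\<nu> ` b \<subseteq> a" using \<nu> by (auto simp: bij_betw_def)
    ultimately obtain e z where e: "(e, z) \<in> C" "rng e = \<nu> ` b" "infinite (rng e)"
      using edges[of "\<nu> ` b"] by auto
    \<comment> \<open>Infinite range forces length \<omega>, so edge and witness can be merged into
      one branch \<open>w\<close>.\<close>
    then obtain x where x: "e = (\<infinity>, x)"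
      using finite_rng_enat by (metis enat.exhaust prod.exhaust)
    then have "\<forall>i. \<exists>m. m \<in> b \<and> x i = \<nu> m" using e(2) by (auto simp: rng_def)
    then obtain m where m: "\<And>i. m i \<in> b" "\<And>i. x i = \<nu> (m i)" by metis
    define w where "w i = prod_encode (m i, z i)" for i
    have "T (rev (map w [0..<n]))" for n
      unfolding T_def using e(1) x m(2) by (auto simp: w_def u_def v_def)
    moreover have "u (w i) \<in> b" for i using m(1) by (simp add: u_def w_def)
    ultimately show ?thesis by blast
  qed
  have dense': "\<exists>r\<le>q. \<exists>m\<ge>n. r \<le> f (\<nu> m)" if q: "q \<le> p" for q n
  proof -
    obtain r x where rx: "r \<le> q" "x \<in> a" "x \<notin> \<nu> ` {..<n}" "r \<le> f x"
      using dense[of "\<nu> ` {..<n}" q] q by auto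
    moreover obtain m where "x = \<nu> m" using rx \<nu> by (auto simp: bij_betw_def)
    ultimately show ?thesis by (metis image_eqI lessThan_iff not_le)
  qed
  let ?L = "leftmost T h"
  let ?e = "branch_name T h (\<lambda>k. \<nu> (u k))" and ?y = "branch_name T h v"
  have "?L q []" if "q \<le> p" for q
  proof -
    have "\<not> ranked T h \<rho> r []" if "r \<le> q" for \<rho> r
      using \<open>q \<le> p\<close> that
      by (intro not_ranked_root[where c = "\<lambda>m. f (\<nu> m)" and u = u] branch)
        (auto simp: h_def intro!: dense' dest: order_trans)
    moreover have "T []"
      using branch[of UNIV] by (metis infinite_UNIV_nat list.map(1) rev.simps(1) upt_0)
    ultimately show ?thesis by (simp add: unranked_def admissible_def)
  qed
  then have L: "?L p []" by simp
  have range: "range (\<lambda>k. \<nu> (u k)) \<subseteq> B" using \<nu> a(3) by (auto simp: bij_betw_def)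
  have "InAnalyticF C \<infinity> ?e q" if "q \<le> p" for q
  proof -
    \<comment> \<open>A node of length \<open>n\<close> fixes the first \<open>n\<close> entries of
      both names and extends to a point of \<open>C\<close>. That point would lie in a basic open
      set disjoint from \<open>C\<close>.\<close>
    have "\<not> InOpenF (seqs UNIV \<times> UNIV - C) \<infinity> ?e ?y r" if r: "r \<le> p" for r
    proof
      assume "InOpenF (seqs UNIV \<times> UNIV - C) \<infinity> ?e ?y r"
      then obtain r' n U s where r': "r' \<le> r"
        and sub: "basic_open \<infinity> n U s \<subseteq> seqs UNIV \<times> UNIV - C"
        and basic: "InBasicF \<infinity> n U s ?e ?y r'"
        unfolding InOpenF_def ExF_def forces_def by blast
      have U: "\<exists>q'\<le>q. \<exists>x\<in>U i. InF (i, x) ?e q'" if "i < n" "q \<le> r'" for i q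
        using basic that by (simp add: InBasicF_def ExF_def AndF_def AllF_def forces_def)
      have s: "InF (i, s i) ?y r'" if "i < n" for i
        using basic that by (simp add: InBasicF_def AndF_def AllF_def forces_def)
      have "?L r' []" using L r r' leftmost_mono by (meson order_trans)
      then obtain q t where t: "q \<le> r'" "length t = n" "?L q t"
        using leftmost_long by blast
      then have "T t" using leftmost_imp_unranked by (auto simp: unranked_def admissible_def)
      then obtain x z where xz: "((\<infinity>, x), z) \<in> C"
        "\<And>i. i < n \<Longrightarrow> x i = \<nu> (u (rev t ! i))" "\<And>i. i < n \<Longrightarrow> z i = v (rev t ! i)"
        using t(2) by (auto simp: T_def)
      have "x i \<in> U i" if i: "i < n" for i
      proof -
        obtain q' x' where q': "q' \<le> q" "x' \<in> U i" "InF (i, x') ?e q'"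
          using U[OF i t(1)] by blast
        moreover have "?L q' t" using t(3) q'(1) by (rule leftmost_mono)
        ultimately have "x' = \<nu> (u (rev t ! i))"
          using InF_branch_nameD[OF q'(3) order_refl] i t(2) by simp
        then show ?thesis using q'(2) xz(2)[OF i] by simp
      qed
      moreover have "z i = s i" if i: "i < n" for i
        using InF_branch_nameD[OF s[OF i] t(1,3)] xz(3)[OF i] i t(2) by simp
      ultimately have "((\<infinity>, x), z) \<in> basic_open \<infinity> n U s"
        by (simp add: basic_open_def)
      then show False using sub xz(1) by blast
    qed
    moreover have "FunF UNIV UNIV ?y r" if "r \<le> p" for r
      using leftmost_mono[OF L that] by (rule FunF_branch_name) simp
    ultimately show ?thesis
      unfolding InAnalyticF_def using that
      by (intro ExFI[of ?y]) (auto simp: AndF_def NotF_def forces_def)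
  qed
  moreover have "FunF UNIV B ?e q" if "q \<le> p" for q
    using leftmost_mono[OF L that] range by (rule FunF_branch_name)
  moreover have "ImpF (InF (i, x) ?e) (InF (f x) generic_name) q" for i x q
  proof -
    have "InF (f x) generic_name r" if r: "InF (i, x) ?e r" for r
    proof -
      \<comment> \<open>Admissibility puts each condition in the name below \<open>h\<close> of the
        entries it decides.\<close>
      have "\<exists>q'\<le>q. q' \<le> f x" if q: "q \<le> r" for q
      proof -
        obtain q' s t where *: "q' \<le> q" "q' \<le> s" "?L s t" "i < length t" "x = \<nu> (u (rev t ! i))"
          using r q unfolding InF_def branch_name_def by blast
        then have "admissible T h s t" using leftmost_imp_unranked by (auto simp: unranked_def)
        then have "s \<le> h (rev t ! i)" using *(4)
          by (metis length_rev nth_mem admissible_def set_rev)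
        then show ?thesis using * by (metis h_def order_trans)
      qed
      then show ?thesis by (auto simp: InF_def generic_name_def)
    qed
    then show ?thesis by (auto simp: ImpF_def NotF_def AndF_def forces_def)
  qed
  ultimately have "AndF (FunF (idx \<infinity>) B ?e) (AndF (InAnalyticF C \<infinity> ?e)
      (AllF (idx \<infinity> \<times> B) (\<lambda>(i, x). ImpF (InF (i, x) ?e) (InF (f x) generic_name)))) q"
    if "q \<le> p" for q
    using that by (auto simp: AndF_def AllF_def forces_def)
  then show ?thesis
    unfolding forces_def GenericEdgeF_def
    by (intro ExFI[of \<infinity>] ExFI[of ?e] UNIV_I) (meson order_trans)
qed

theorem theorem3p59:
  fixes \<G> :: "'a::polish_space hypergraph set"
  assumes "countable \<G>"
    and "\<forall>G\<in>\<G>. analytic_in seq_space G"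
    and "small_anticlique_property \<G>"
    and "\<forall>G\<in>\<G>. \<forall>e\<in>G. infinite (rng e)"
    and "\<forall>G\<in>\<G>. \<forall>e\<in>G. \<forall>a\<subseteq>rng e. infinite a \<longrightarrow> (\<exists>e'\<in>G. rng e' = a)"
    and "sigma_liminf_centered TYPE('p::order)"
  shows "not_perp_star \<G> TYPE('p)"
  unfolding not_perp_star_def
proof (intro ballI impI allI)
  fix B :: "'a set" and f :: "'a \<Rightarrow> 'p" and G
  assume B: "B \<in> sets borel" "B \<notin> hg_ideal \<G>" and G: "G \<in> \<G>"
  obtain Q :: "nat \<Rightarrow> 'p set" where Q: "\<And>n. liminf_centered (Q n)" "(\<Union>n. Q n) = UNIV"
    using assms(6) unfolding sigma_liminf_centered_def by blast
  have "B \<subseteq> (\<Union>n. {x \<in> B. f x \<in> Q n})" using Q(2) by blast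
  \<comment> \<open>\<open>G\<close> is used at every index, and \<open>B\<close> itself is the
    analytic positive subset of the union.\<close>
  then obtain n where "\<not> anticlique G {x \<in> B. f x \<in> Q n}"
    using assms(3)[unfolded small_anticlique_property_def, rule_format,
        of "\<lambda>_. G" "\<lambda>n. {x \<in> B. f x \<in> Q n}"] B G analytic_in_borel by blast
  then obtain e where e: "e \<in> G" "e \<in> seqs {x \<in> B. f x \<in> Q n}"
    unfolding anticlique_def by blast
  then have rng: "rng e \<subseteq> B" "f ` rng e \<subseteq> Q n"
    by (auto simp: seqs_def rng_def)
  have inf: "infinite (rng e)" using assms(4) G e(1) by blast
  have "\<exists>a p. a \<subseteq> rng e \<and> infinite a \<and>
      (\<forall>F q. finite F \<longrightarrow> q \<le> p \<longrightarrow> (\<exists>r\<le>q. \<exists>x\<in>a - F. r \<le> f x))"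
  proof (cases "finite (f ` rng e)")
    case True
    \<comment> \<open>Where \<open>f\<close> is constant, its value serves as the condition
      \<open>p\<close>.\<close>
    obtain x where x: "infinite {y \<in> rng e. f y = f x}"
      using pigeonhole_infinite[OF inf True] by blast
    have "\<exists>r\<le>q. \<exists>y\<in>{y \<in> rng e. f y = f x} - F. r \<le> f y" if "finite F" "q \<le> f x" for F q
    proof -
      have "infinite ({y \<in> rng e. f y = f x} - F)"
        using that(1) x by (rule Diff_infinite_finite)
      then obtain y where "y \<in> {y \<in> rng e. f y = f x} - F"
        by (metis finite.emptyI equals0I)
      then show ?thesis using that(2) by force
    qed
    then show ?thesis using x by (intro exI[of _ "{y \<in> rng e. f y = f x}"] exI[of _ "f x"]) auto
  next
    case False
    obtain a where a: "a \<subseteq> rng e" "f ` a = f ` rng e"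
      using subset_image_inj[of "f ` rng e" f "rng e"] by auto
    have "infinite a" using False a(2) by (metis finite_imageI)
    obtain p where "p \<tturnstile> inf_many_generic (f ` a)"
      using Q(1)[of n] rng(2) False a(2) unfolding liminf_centered_def by metis
    then have p: "\<exists>r\<le>q. \<exists>b\<in>f ` a - F. InF b generic_name r"
      if "finite F" "F \<subseteq> f ` a" "q \<le> p" for F q
      using that unfolding inf_many_generic_def AllF_def ExF_def forces_def by blast
    have "\<exists>r\<le>q. \<exists>x\<in>a - F. r \<le> f x" if "finite F" "q \<le> p" for F q
    proof -
      \<comment> \<open>Excluding the values of \<open>f\<close> on \<open>a \<inter> F\<close>
        keeps \<open>x\<close> outside \<open>F\<close>.\<close>
      obtain r x where r: "r \<le> q" "x \<in> a" "f x \<notin> f ` (a \<inter> F)" "InF (f x) generic_name r"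
        using p[of "f ` (a \<inter> F)" q] \<open>finite F\<close> \<open>q \<le> p\<close> by blast
      then obtain r' where "r' \<le> r" "r' \<le> f x"
        unfolding InF_def generic_name_def by blast
      then show ?thesis using r by (metis DiffI IntI imageI order_trans)
    qed
    then show ?thesis using a(1) \<open>infinite a\<close> by blast
  qed
  then obtain a p where a: "a \<subseteq> rng e" "infinite a"
    and p: "\<And>F q. finite F \<Longrightarrow> q \<le> p \<Longrightarrow> \<exists>r\<le>q. \<exists>x\<in>a - F. r \<le> f x"
    by metis
  have "countable (rng e)" by (simp add: rng_def)
  then have "countable a" using a(1) by (rule countable_subset[rotated])
  moreover have "\<exists>e'\<in>G. rng e' = a'" if "a' \<subseteq> a" "infinite a'" for a'
    using assms(5) G e(1) a(1) that by (meson order_trans)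
  \<comment> \<open>\<open>a\<close> and \<open>p\<close> were found without reference to a code, so
    one condition serves every \<open>C\<close>.\<close>
  ultimately have "p \<tturnstile> GenericEdgeF C B f" if "analytic_code seq_space C G" for C
    using that a rng(1) p by (intro forces_GenericEdgeF[of a]) (auto simp: analytic_code_def)
  then show "\<exists>p. \<forall>C. analytic_code seq_space C G \<longrightarrow> p \<tturnstile> GenericEdgeF C B f" by blast
qed

end
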